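(* Let $G$ and $G'$ be finite loopless directed graphs without parallel edges. If $\varphi:G\to G'$ is an isomorphism of directed graphs, then the induced edge bijection sends $\Pi_{\mathrm{opp}}(G)$ to $\Pi_{\mathrm{opp}}(G')$ (that is, it maps the blocks of $\Pi_{\mathrm{opp}}(G)$ bijectively onto the blocks of $\Pi_{\mathrm{opp}}(G')$). In particular, every automorphism of $G$ fixes $\Pi_{\mathrm{opp}}(G)$ as an unlabelled edge partition.
   Context: For a finite loopless directed graph $G=(V,E)$ without parallel edges, a directed two-step diamond pattern is a quadruple of distinct vertices $(x,a,b,y)$ with $(x,a),(x,b),(a,y),(b,y)\in E$ (additional arcs among the four vertices are allowed). Its two opposite pairs are $\{(x,a),(b,y)\}$ and $\{(x,b),(a,y)\}$. $\Omega(G)$ is the undirected graph with vertex set $E$ in which two directed edges are joined whenever they form an opposite pair of some directed two-step diamond pattern. The opposite-diamond partition $\Pi_{\mathrm{opp}}(G)$ is the set of connected components of $\Omega(G)$, an unlabelled partition of $E$. *)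

theory Defs
  imports "Graph_Theory.Graph_Theory" "HOL-Library.Disjoint_Sets"
begin

definition diamond_pattern :: "'a pair_pre_digraph \<Rightarrow> 'a \<Rightarrow> 'a \<Rightarrow> 'a \<Rightarrow> 'a \<Rightarrow> bool" where
  "diamond_pattern G x a b y \<longleftrightarrow>
     {x, a, b, y} \<subseteq> pverts G \<and> distinct [x, a, b, y] \<and>
     {(x, a), (x, b), (a, y), (b, y)} \<subseteq> parcs G"

definition opposite_pair :: "'a pair_pre_digraph \<Rightarrow> ('a \<times> 'a) set \<Rightarrow> bool" where
  "opposite_pair G P \<longleftrightarrow>
     (\<exists>x a b y. diamond_pattern G x a b y \<and>
        (P = {(x, a), (b, y)} \<or> P = {(x, b), (a, y)}))"

(* The undirected graph Omega(G), represented (as usual in Graph_Theory) by a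
   symmetric digraph; see pair_graph_Omega. *)
definition Omega :: "'a pair_pre_digraph \<Rightarrow> ('a \<times> 'a) pair_pre_digraph" where
  "Omega G = \<lparr> pverts = parcs G, parcs = {(e, f). opposite_pair G {e, f}} \<rparr>"

(* Omega G is symmetric, so its strongly connected components are the connected
   components of the undirected graph; see opp_partition_eq_quotient. *)
definition opp_partition :: "'a pair_pre_digraph \<Rightarrow> ('a \<times> 'a) set set" where
  "opp_partition G = pre_digraph.sccs_verts (with_proj (Omega G))"

(* The library's isomorphisms carry a separate arc map and the tail and head
   functions of the target. For arcs that are pairs of vertices, these are all
   determined by the vertex map. *)
definition induced_iso :: "('a \<Rightarrow> 'b) \<Rightarrow> ('a, 'a \<times> 'a, 'b, 'b \<times> 'b) digraph_isomorphism" where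
  "induced_iso \<phi> =
     \<lparr> iso_verts = \<phi>, iso_arcs = map_prod \<phi> \<phi>, iso_head = snd, iso_tail = fst \<rparr>"

(* See is_digraph_iso_iff for the textbook form. *)
definition is_digraph_iso ::
  "('a \<Rightarrow> 'b) \<Rightarrow> 'a pair_pre_digraph \<Rightarrow> 'b pair_pre_digraph \<Rightarrow> bool" where
  "is_digraph_iso \<phi> G G' \<longleftrightarrow>
     pre_digraph.digraph_isomorphism (with_proj G) (induced_iso \<phi>) \<and>
     with_proj G' = app_iso (induced_iso \<phi>) (with_proj G)"

lemma is_digraph_iso_iff:
  assumes "pair_wf_digraph G" "pair_wf_digraph G'"
  shows "is_digraph_iso \<phi> G G' \<longleftrightarrow>
    bij_betw \<phi> (pverts G) (pverts G') \<and>
    (\<forall>u\<in>pverts G. \<forall>v\<in>pverts G. (u, v) \<in> parcs G \<longleftrightarrow> (\<phi> u, \<phi> v) \<in> parcs G')"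
    (is "?L \<longleftrightarrow> ?R")
proof -
  interpret G: pair_wf_digraph G by fact
  interpret H: pair_wf_digraph G' by fact
  have wf: "wf_digraph (with_proj G)" by (rule G.wf_digraph)
  have L: "?L \<longleftrightarrow> inj_on \<phi> (pverts G) \<and> inj_on (map_prod \<phi> \<phi>) (parcs G) \<and>
      pverts G' = \<phi> ` pverts G \<and> parcs G' = map_prod \<phi> \<phi> ` parcs G"
    using wf by (auto simp: is_digraph_iso_def induced_iso_def app_iso_def with_proj_def
        pre_digraph.digraph_isomorphism_def)
  have inj: "inj_on (map_prod \<phi> \<phi>) (parcs G)" if "inj_on \<phi> (pverts G)"
    using map_prod_inj_on[OF that that]
    by (rule inj_on_subset) (auto dest: G.in_arcsD1 G.in_arcsD2)
  show ?thesis
  proof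
    assume l: ?L
    then have i: "inj_on \<phi> (pverts G)" and v: "pverts G' = \<phi> ` pverts G"
      and a: "parcs G' = map_prod \<phi> \<phi> ` parcs G" using L by auto
    have "(u, v) \<in> parcs G" if uv: "u \<in> pverts G" "v \<in> pverts G" "(\<phi> u, \<phi> v) \<in> parcs G'" for u v
    proof -
      obtain p q where pq: "(p, q) \<in> parcs G" "\<phi> u = \<phi> p" "\<phi> v = \<phi> q"
        using uv(3) a by auto
      have "u = p" "v = q"
        using inj_onD[OF i pq(2) uv(1) G.in_arcsD1[OF pq(1)]]
          inj_onD[OF i pq(3) uv(2) G.in_arcsD2[OF pq(1)]] by auto
      then show ?thesis using pq(1) by simp
    qed
    moreover have "(\<phi> u, \<phi> v) \<in> parcs G'" if "(u, v) \<in> parcs G" for u v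
      using that a by force
    ultimately show ?R using i v by (simp add: bij_betw_def) metis
  next
    assume r: ?R
    then have i: "inj_on \<phi> (pverts G)" and v: "pverts G' = \<phi> ` pverts G"
      by (auto simp: bij_betw_def)
    have "parcs G' = map_prod \<phi> \<phi> ` parcs G"
    proof (intro equalityI subsetI)
      fix e assume e: "e \<in> parcs G'"
      obtain p q where pq: "e = (p, q)" by (cases e)
      with e have "p \<in> pverts G'" "q \<in> pverts G'" using H.in_arcsD1[of p q] H.in_arcsD2[of p q] by auto
      then obtain u w where uw: "u \<in> pverts G" "w \<in> pverts G" "p = \<phi> u" "q = \<phi> w"
        using v by auto
      then have "(u, w) \<in> parcs G" using r e pq by auto
      then show "e \<in> map_prod \<phi> \<phi> ` parcs G" using uw pq by force
    next
      fix e assume "e \<in> map_prod \<phi> \<phi> ` parcs G"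
      then obtain u w where "(u, w) \<in> parcs G" "e = (\<phi> u, \<phi> w)" by auto
      then show "e \<in> parcs G'" using r G.in_arcsD1[of u w] G.in_arcsD2[of u w] by blast
    qed
    then show ?L using L i v inj by auto
  qed
qed

lemma Omega_simps [simp]:
  "pverts (Omega G) = parcs G"
  "parcs (Omega G) = {(e, f). opposite_pair G {e, f}}"
  by (simp_all add: Omega_def)

lemma opposite_pairD:
  assumes "opposite_pair G {e, f}"
  shows "e \<in> parcs G" "f \<in> parcs G" "e \<noteq> f"
  using assms by (auto simp: opposite_pair_def diamond_pattern_def doubleton_eq_iff)

lemma pair_graph_Omega:
  assumes "pair_digraph G"
  shows "pair_graph (Omega G)"
proof -
  interpret pair_digraph G by fact
  have sub: "parcs (Omega G) \<subseteq> parcs G \<times> parcs G"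
    using opposite_pairD(1,2)[of G] by (simp add: subset_iff)
  have "finite (parcs (Omega G))"
    by (rule finite_subset[OF sub]) (simp add: pair_finite_arcs)
  moreover have "sym (parcs (Omega G))"
    by (rule symI) (simp add: insert_commute)
  moreover have "fst p \<noteq> snd p" if "p \<in> parcs (Omega G)" for p
    using that opposite_pairD(3)[of G "fst p" "snd p"] by (simp add: case_prod_unfold)
  moreover have "fst p \<in> parcs G" "snd p \<in> parcs G" if "p \<in> parcs (Omega G)" for p
    using that sub by (auto simp del: Omega_simps(2))
  ultimately show ?thesis
    by unfold_locales (simp_all add: pair_finite_arcs symmetric_def del: Omega_simps(2))
qed

lemma opp_partition_eq_quotient:
  assumes "pair_digraph G"
  defines "R \<equiv> {(e, f). e \<rightarrow>\<^sup>*\<^bsub>with_proj (Omega G)\<^esub> f}"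
  shows "equiv (parcs G) R" "opp_partition G = parcs G // R" "partition_on (parcs G) (opp_partition G)"
proof -
  interpret O: pair_graph "Omega G" using assms(1) by (rule pair_graph_Omega)
  have V: "e \<in> parcs G" "f \<in> parcs G" if "(e, f) \<in> R" for e f
    using that O.reachable_in_verts by (auto simp: R_def)
  have rr: "(e, e) \<in> R" if "e \<in> parcs G" for e
    using that by (auto simp: R_def)
  have rs: "(f, e) \<in> R" if "(e, f) \<in> R" for e f
    using that symmetric_reachable[OF O.sym_arcs] by (auto simp: R_def)
  have rt: "(e, g) \<in> R" if "(e, f) \<in> R" "(f, g) \<in> R" for e f g
    using that O.reachable_trans[of e f g] by (simp add: R_def)
  show eq: "equiv (parcs G) R"
  proof (rule equivI)
    show "R \<subseteq> parcs G \<times> parcs G" using V by auto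
    show "refl_on (parcs G) R" using rr by (simp add: refl_on_def)
    show "sym R" using rs by (rule symI)
    show "trans R" using rt by (rule transI)
  qed
  have S: "opp_partition G = {S. S \<noteq> {} \<and> (\<forall>u\<in>S. \<forall>v\<in>S. (u, v) \<in> R) \<and>
      (\<forall>u\<in>S. \<forall>v. v \<notin> S \<longrightarrow> (u, v) \<notin> R \<or> (v, u) \<notin> R)}"
    by (simp add: opp_partition_def pre_digraph.sccs_verts_def R_def)
  show q: "opp_partition G = parcs G // R"
  proof (intro equalityI subsetI)
    fix S assume "S \<in> opp_partition G"
    then have s: "S \<noteq> {}" "\<forall>u\<in>S. \<forall>v\<in>S. (u, v) \<in> R"
        "\<forall>u\<in>S. \<forall>v. v \<notin> S \<longrightarrow> (u, v) \<notin> R \<or> (v, u) \<notin> R"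
      unfolding S by auto
    then obtain u where u: "u \<in> S" by auto
    have "S = R `` {u}"
    proof (intro equalityI subsetI)
      fix v assume "v \<in> S"
      then show "v \<in> R `` {u}" using s(2) u by blast
    next
      fix v assume "v \<in> R `` {u}"
      then have "(u, v) \<in> R" by simp
      with rs[OF this] s(3) u show "v \<in> S" by metis
    qed
    then show "S \<in> parcs G // R" using u s(2) V(1)[of u u] by (simp add: quotientI)
  next
    fix S assume "S \<in> parcs G // R"
    then obtain e where e: "e \<in> parcs G" and Se: "S = R `` {e}" by (rule quotientE)
    have mem: "u \<in> S \<longleftrightarrow> (e, u) \<in> R" for u by (simp add: Se)
    have "S \<noteq> {}" using rr[OF e] mem by blast
    moreover have "(u, v) \<in> R" if "u \<in> S" "v \<in> S" for u v
      using rt[OF rs, of e u v] that by (simp add: mem)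
    moreover have "(u, v) \<notin> R" if "u \<in> S" "v \<notin> S" for u v
      using rt[of e u v] that by (auto simp: mem)
    ultimately show "S \<in> opp_partition G" unfolding S by simp
  qed
  show "partition_on (parcs G) (opp_partition G)"
    unfolding q by (rule partition_on_quotient) (rule eq)
qed

end

theory Submission
  imports Defs
begin

text \<open>
  An isomorphism \<open>\<phi>\<close> preserves and reflects diamond patterns, hence opposite pairs, so the edge
  bijection it induces is an isomorphism from \<open>Omega G\<close> to \<open>Omega G'\<close>; and an isomorphism of
  digraphs carries strongly connected components to strongly connected components.
\<close>

context wf_digraph
begin

lemma reachable_app_iso_verts_iff:
  assumes "digraph_isomorphism h" "u \<in> verts G" "v \<in> verts G"
  shows "iso_verts h u \<rightarrow>\<^sup>*\<^bsub>app_iso h G\<^esub> iso_verts h v \<longleftrightarrow> u \<rightarrow>\<^sup>* v"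
  using assms by (simp add: reachable_app_iso_eq)

text \<open>Membership in a strong component is reachability in both directions, and an isomorphism
  preserves and reflects reachability between vertices of \<open>G\<close>.\<close>

lemma scc_of_app_iso:
  assumes h: "digraph_isomorphism h" and u: "u \<in> verts G"
  shows "pre_digraph.scc_of (app_iso h G) (iso_verts h u) = iso_verts h ` scc_of u"
proof -
  interpret H: wf_digraph "app_iso h G" using h by (rule wf_digraphI_app_iso)
  have "H.scc_of (iso_verts h u) \<subseteq> iso_verts h ` scc_of u"
  proof
    fix w assume w: "w \<in> H.scc_of (iso_verts h u)"
    \<comment> \<open>Reachability is reflected only for images of vertices of \<open>G\<close>, so
      \<open>w\<close> is first shown to be one.\<close>
    then have "w \<in> verts (app_iso h G)"
      by (auto simp: H.scc_of_def dest: H.reachable_in_verts)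
    then obtain v where "v \<in> verts G" "w = iso_verts h v" by auto
    with w u show "w \<in> iso_verts h ` scc_of u"
      by (auto simp: H.scc_of_def scc_of_def reachable_app_iso_verts_iff[OF h])
  qed
  then show ?thesis
    by (auto simp: H.scc_of_def scc_of_def intro: reachableI_app_iso[OF _ h])
qed

lemma sccs_verts_app_iso:
  assumes h: "digraph_isomorphism h"
  shows "pre_digraph.sccs_verts (app_iso h G) = (`) (iso_verts h) ` sccs_verts"
proof -
  interpret H: wf_digraph "app_iso h G" using h by (rule wf_digraphI_app_iso)
  show ?thesis
    by (simp add: sccs_verts_conv_scc_of H.sccs_verts_conv_scc_of image_image
        scc_of_app_iso[OF h])
qed

end

text \<open>By definition \<open>is_digraph_iso\<close> makes \<open>with_proj G'\<close> equal to
  \<open>app_iso (induced_iso \<phi>) (with_proj G)\<close>, so the general result transfers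
  directly to pair digraphs.\<close>

lemma sccs_verts_is_digraph_iso:
  assumes "wf_digraph (with_proj G)" "is_digraph_iso \<phi> G G'"
  shows "pre_digraph.sccs_verts (with_proj G') = (`) \<phi> ` pre_digraph.sccs_verts (with_proj G)"
  using assms wf_digraph.sccs_verts_app_iso[of "with_proj G" "induced_iso \<phi>"]
  by (simp add: is_digraph_iso_def induced_iso_def)

lemma is_digraph_iso_parcs:
  assumes "is_digraph_iso \<phi> G G'"
  shows "bij_betw (map_prod \<phi> \<phi>) (parcs G) (parcs G')"
  using assms
  by (auto simp: is_digraph_iso_def induced_iso_def app_iso_def with_proj_def
      pre_digraph.digraph_isomorphism_def bij_betw_def)

lemma diamond_pattern_iso_iff:
  assumes "bij_betw \<phi> (pverts G) (pverts G')"
    and "\<forall>u\<in>pverts G. \<forall>v\<in>pverts G. (u, v) \<in> parcs G \<longleftrightarrow> (\<phi> u, \<phi> v) \<in> parcs G'"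
    and "x \<in> pverts G" "a \<in> pverts G" "b \<in> pverts G" "y \<in> pverts G"
  shows "diamond_pattern G' (\<phi> x) (\<phi> a) (\<phi> b) (\<phi> y) \<longleftrightarrow> diamond_pattern G x a b y"
  using assms bij_betwE[OF assms(1)]
  by (simp add: diamond_pattern_def inj_on_eq_iff[OF bij_betw_imp_inj_on[OF assms(1)]])

lemma diamond_patternD:
  assumes "diamond_pattern G x a b y"
  shows "x \<in> pverts G" "a \<in> pverts G" "b \<in> pverts G" "y \<in> pverts G"
    "(x, a) \<in> parcs G" "(x, b) \<in> parcs G" "(a, y) \<in> parcs G" "(b, y) \<in> parcs G"
  using assms by (auto simp: diamond_pattern_def)

text \<open>A diamond in \<open>G\<close> is pushed forward along \<open>\<phi>\<close>; a diamond
  in \<open>G'\<close> is pulled back by surjectivity on vertices. Injectivity on arcs then recovers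
  \<open>P\<close> from its image.\<close>

lemma opposite_pair_iso_iff:
  assumes wf: "pair_wf_digraph G" "pair_wf_digraph G'" and iso: "is_digraph_iso \<phi> G G'"
    and P: "P \<subseteq> parcs G"
  shows "opposite_pair G' (map_prod \<phi> \<phi> ` P) \<longleftrightarrow> opposite_pair G P"
proof
  have bij: "bij_betw \<phi> (pverts G) (pverts G')"
    and adj: "\<forall>u\<in>pverts G. \<forall>v\<in>pverts G. (u, v) \<in> parcs G \<longleftrightarrow> (\<phi> u, \<phi> v) \<in> parcs G'"
    using iso by (simp_all add: is_digraph_iso_iff[OF wf])
  note diamond = diamond_pattern_iso_iff[OF bij adj]
  show "opposite_pair G' (map_prod \<phi> \<phi> ` P)" if "opposite_pair G P"
  proof -
    obtain x a b y where d: "diamond_pattern G x a b y"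
      and P: "P = {(x, a), (b, y)} \<or> P = {(x, b), (a, y)}"
      using \<open>opposite_pair G P\<close> by (auto simp: opposite_pair_def)
    have "diamond_pattern G' (\<phi> x) (\<phi> a) (\<phi> b) (\<phi> y)"
      using d diamond_patternD[OF d] by (simp add: diamond)
    moreover have "map_prod \<phi> \<phi> ` P = {(\<phi> x, \<phi> a), (\<phi> b, \<phi> y)} \<or>
        map_prod \<phi> \<phi> ` P = {(\<phi> x, \<phi> b), (\<phi> a, \<phi> y)}"
      using P by auto
    ultimately show ?thesis unfolding opposite_pair_def by blast
  qed
  assume "opposite_pair G' (map_prod \<phi> \<phi> ` P)"
  then obtain x' a' b' y' where d': "diamond_pattern G' x' a' b' y'"
    and P': "map_prod \<phi> \<phi> ` P = {(x', a'), (b', y')} \<or> map_prod \<phi> \<phi> ` P = {(x', b'), (a', y')}"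
    by (auto simp: opposite_pair_def)
  obtain x a b y where V: "x \<in> pverts G" "a \<in> pverts G" "b \<in> pverts G" "y \<in> pverts G"
    and eq: "x' = \<phi> x" "a' = \<phi> a" "b' = \<phi> b" "y' = \<phi> y"
    using diamond_patternD(1-4)[OF d'] unfolding bij_betw_imp_surj_on[OF bij, symmetric]
    by (auto elim!: imageE)
  have d: "diamond_pattern G x a b y" using d' V by (simp add: eq diamond)
  \<comment> \<open>To be applied with \<open>Q\<close> an opposite pair of the pulled-back diamond,
    which consists of arcs of \<open>G\<close>.\<close>
  have inj: "map_prod \<phi> \<phi> ` P = map_prod \<phi> \<phi> ` Q \<longleftrightarrow> P = Q" if "Q \<subseteq> parcs G" for Q
    using inj_on_image_eq_iff[OF bij_betw_imp_inj_on[OF is_digraph_iso_parcs[OF iso]] P that] .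
  have "P = {(x, a), (b, y)} \<or> P = {(x, b), (a, y)}"
    using P' inj[of "{(x, a), (b, y)}"] inj[of "{(x, b), (a, y)}"] diamond_patternD[OF d]
    by (simp add: eq)
  with d show "opposite_pair G P" by (auto simp: opposite_pair_def)
qed

text \<open>The arcs of \<open>G\<close> are the vertices of \<open>Omega G\<close>, so the arc map
  of \<open>\<phi>\<close> becomes a vertex map. Adjacency is \<open>opposite_pair\<close> on
  doubletons, and the textbook form of isomorphism applies.\<close>

lemma is_digraph_iso_Omega:
  assumes "pair_digraph G" "pair_digraph G'" "is_digraph_iso \<phi> G G'"
  shows "is_digraph_iso (map_prod \<phi> \<phi>) (Omega G) (Omega G')"
proof -
  note wf = pair_digraph.pair_wf_digraph
  have "pair_wf_digraph (Omega G)" "pair_wf_digraph (Omega G')"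
    using assms(1,2)[THEN pair_graph_Omega] by (simp_all add: pair_graph_def wf)
  moreover have "opposite_pair G' {map_prod \<phi> \<phi> e, map_prod \<phi> \<phi> f} \<longleftrightarrow> opposite_pair G {e, f}"
    if "e \<in> parcs G" "f \<in> parcs G" for e f
    using opposite_pair_iso_iff[OF wf[OF assms(1)] wf[OF assms(2)] assms(3), of "{e, f}"] that by simp
  ultimately show ?thesis
    using is_digraph_iso_parcs[OF assms(3)] by (simp add: is_digraph_iso_iff)
qed

lemma opp_partition_iso:
  assumes "pair_digraph G" "pair_digraph G'" "is_digraph_iso \<phi> G G'"
  shows "opp_partition G' = (`) (map_prod \<phi> \<phi>) ` opp_partition G"
proof -
  interpret O: pair_graph "Omega G" using assms(1) by (rule pair_graph_Omega)
  show ?thesis unfolding opp_partition_def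
    by (rule sccs_verts_is_digraph_iso[OF O.wf_digraph is_digraph_iso_Omega[OF assms]])
qed

lemma bij_betw_opp_partition:
  assumes "pair_digraph G" "pair_digraph G'" "is_digraph_iso \<phi> G G'"
  shows "bij_betw ((`) (map_prod \<phi> \<phi>)) (opp_partition G) (opp_partition G')"
proof (rule bij_betw_imageI)
  \<comment> \<open>Taking images is injective only on sets of arcs of \<open>G\<close>, where
    \<open>map_prod \<phi> \<phi>\<close> is injective; every block is such a set.\<close>
  have "opp_partition G \<subseteq> Pow (parcs G)"
    using partition_onD1[OF opp_partition_eq_quotient(3)[OF assms(1)]] by blast
  then show "inj_on ((`) (map_prod \<phi> \<phi>)) (opp_partition G)"
    using inj_on_image_Pow[OF bij_betw_imp_inj_on[OF is_digraph_iso_parcs[OF assms(3)]]]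
    by (rule inj_on_subset[rotated])
qed (simp add: opp_partition_iso[OF assms])

text \<open>Since \<open>'a\<close> and \<open>'b\<close> are distinct type variables, the
  automorphism clause is not an instance of the first conjunct; it comes from
  \<open>opp_partition_iso\<close> with \<open>G\<close> as its own target.\<close>

theorem theorem3p1:
  fixes G :: "'a pair_pre_digraph"
  assumes "pair_digraph G"
  shows "(\<forall>(G' :: 'b pair_pre_digraph) \<phi>.
            pair_digraph G' \<longrightarrow> is_digraph_iso \<phi> G G' \<longrightarrow>
              bij_betw (map_prod \<phi> \<phi>) (parcs G) (parcs G') \<and>
              bij_betw (\<lambda>B. map_prod \<phi> \<phi> ` B) (opp_partition G) (opp_partition G')) \<and>
         (\<forall>\<psi>. is_digraph_iso \<psi> G G \<longrightarrow>
              (\<lambda>B. map_prod \<psi> \<psi> ` B) ` opp_partition G = opp_partition G)"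
  using is_digraph_iso_parcs bij_betw_opp_partition[OF assms] opp_partition_iso[OF assms assms]
  by auto

end
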